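(* (Soundness of $\mathbf{FRJ}(G)$.) For every propositional formula $G$: if $G$ is provable in $\mathbf{FRJ}(G)$, i.e. there is a set $\Gamma$ such that the regular sequent $\Gamma\Rightarrow G$ is derivable in $\mathbf{FRJ}(G)$, then $G$ is not valid in intuitionistic propositional logic ($G\notin\mathrm{IPL}$). This holds for the calculus $\mathbf{FRJ}(G)$ as given by the rules below, without imposing the additional restrictions (R1)–(R4).
   Context: Formulas are built from a countably infinite set $\mathcal{V}$ of propositional variables and the constant $\bot$ using $\land,\lor,\supset$; $\neg A$ abbreviates $A\supset\bot$. Let $\mathcal{V}_\bot=\mathcal{V}\cup\{\bot\}$ and let $\mathcal{L}^{\supset}$ be the set of formulas with main connective $\supset$. For a formula $G$, the sets $\mathrm{Sl}(G)$ and $\mathrm{Sr}(G)$ of left and right subformulas are the smallest subsets of the set of subformulas of $G$ such that: $G\in\mathrm{Sr}(G)$; if $A\land B$ or $A\lor B$ belongs to $\mathrm{Sl}(G)$ (resp. $\mathrm{Sr}(G)$) then $A,B$ belong to $\mathrm{Sl}(G)$ (resp. $\mathrm{Sr}(G)$); if $A\supset B\in\mathrm{Sl}(G)$ then $B\in\mathrm{Sl}(G)$ and $A\in\mathrm{Sr}(G)$; if $A\supset B\in\mathrm{Sr}(G)$ then $B\in\mathrm{Sr}(G)$ and $A\in\mathrm{Sl}(G)$. The closure $\mathrm{Cl}(\Gamma)$ of a set of formulas $\Gamma$ is the smallest set containing $\Gamma$ such that whenever $X,Y\in\mathrm{Cl}(\Gamma)$ and $A$ is an arbitrary formula, $X\land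 Y$, $A\lor X$, $X\lor A$, $A\supset X\in\mathrm{Cl}(\Gamma)$. Let $\bar\Gamma^{At}=\mathrm{Sl}(G)\cap\mathcal{V}$, $\bar\Gamma^{\supset}=\mathrm{Sl}(G)\cap\mathcal{L}^{\supset}$, $\bar\Gamma=\bar\Gamma^{At}\cup\bar\Gamma^{\supset}$. $\mathbf{FRJ}(G)$-sequents are regular sequents $\Gamma\Rightarrow C$ with $\Gamma\subseteq\bar\Gamma$, $C\in\mathrm{Sr}(G)$, and irregular sequents $\Sigma;\Theta\rightarrow C$ with $\Sigma\cup\Theta\subseteq\bar\Gamma$, $C\in\mathrm{Sr}(G)$. Commas in sets denote union. In every rule the right formula of the conclusion belongs to $\mathrm{Sr}(G)$. Rules ($F\in\mathcal{V}_\bot$, $k\in\{1,2\}$): (Ax$_\Rightarrow$) axiom $\bar\Gamma^{At}\setminus\{F\}\Rightarrow F$. (Ax$_\rightarrow$) axiom $\emptyset;(\bar\Gamma^{At}\setminus\{F\})\cup\bar\Gamma^{\supset}\rightarrow F$. ($\land$) from $\Gamma\Rightarrow A_k$ infer $\Gamma\Rightarrow A_1\land A_2$; from $\Sigma;\Theta\rightarrow A_k$ infer $\Sigma;\Theta\rightarrow A_1\land A_2$. ($\lor$) from $\Sigma_1;\Theta_1\rightarrow C_1$ and $\Sigma_2;\Theta_2\rightarrow C_2$ infer $\Sigma_1\cup\Sigma_2;\Theta_1\cap\Theta_2\rightarrow C_1\lor C_2$, provided $\Sigma_1\subseteq\Sigma_2\cup\Theta_2$ and $\Sigma_2\subseteq\Sigma_1\cup\Theta_1$.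 ($\supset_\in$) from $\Gamma\Rightarrow B$ infer $\Gamma\Rightarrow A\supset B$ provided $A\in\mathrm{Cl}(\Gamma)$; from $\Sigma;\Theta\cup\Lambda\rightarrow B$ with $\Theta\cap\Lambda=\emptyset$ infer $\Sigma\cup\Lambda;\Theta\rightarrow A\supset B$ provided $A\in\mathrm{Cl}(\Sigma\cup\Lambda)$. ($\supset_{\notin}$) from $\Gamma\Rightarrow B$ infer $\emptyset;\Theta\rightarrow A\supset B$ provided $\Theta\subseteq\mathrm{Cl}(\Gamma)\cap\bar\Gamma$ and $A\in\mathrm{Cl}(\Gamma)\setminus\mathrm{Cl}(\Theta)$. (Join rules) premises $\Sigma_j;\Theta_j\rightarrow A_j$ for $1\le j\le n$, $n\ge1$. Let $\Upsilon=\{A_1,\dots,A_n\}$, $\Sigma^{At}=\bigcup_j(\Sigma_j\cap\mathcal V)$, $\Sigma^{\supset}=\bigcup_j(\Sigma_j\cap\mathcal L^{\supset})$, $\Theta^{At}=\bigcap_j(\Theta_j\cap\mathcal V)$, $\Theta^{\supset}=\{Y\supset Z\in\bigcap_j(\Theta_j\cap\mathcal L^{\supset}) : Y\in\Upsilon\}$. Side conditions for both: (J1) $\Sigma_i\subseteq\Sigma_j\cup\Theta_j$ for all $i\neq j$; (J2) $Y\supset Z\in\Sigma^{\supset}$ implies $Y\in\Upsilon$. ($\bowtie^{At}$) conclusion $\Sigma^{At}\cup(\Theta^{At}\setminus\{F\})\cup\Sigma^{\supset}\cup\Theta^{\supset}\Rightarrow F$ with $F\in\mathcal V_\bot\setminus\Sigma^{At}$.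 ($\bowtie^{\lor}$) conclusion $\Sigma^{At}\cup\Theta^{At}\cup\Sigma^{\supset}\cup\Theta^{\supset}\Rightarrow C_1\lor C_2$ with $\{C_1,C_2\}\subseteq\Upsilon$. (The restrictions (R1)–(R4), not imposed here, are: minimality of $\Lambda$ in irregular $\supset_\in$; maximality of $\Theta$ in $\supset_{\notin}$; and conditions on $\Upsilon$ in the join rules.) A derivation is a finite tree of sequents built by these rules with axioms at the leaves. Kripke models, forcing and $\mathrm{IPL}$ (the set of formulas forced at the root of every finite rooted Kripke model) are standard. *)

theory Defs
  imports Main
begin

datatype form =
    Var nat
  | Bot
  | And form form
  | Or form form
  | Imp form form

abbreviation Neg :: "form \<Rightarrow> form" where
  "Neg A \<equiv> Imp A Bot"

definition Vars :: "form set" where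
  "Vars = range Var"

definition VarsBot :: "form set" where
  "VarsBot = insert Bot Vars"

definition Imps :: "form set" where
  "Imps = {A. \<exists>B C. A = Imp B C}"

inductive_set Sl :: "form \<Rightarrow> form set" and Sr :: "form \<Rightarrow> form set" for G :: form where
  Sr_self: "G \<in> Sr G"
| Sl_And1: "And A B \<in> Sl G \<Longrightarrow> A \<in> Sl G"
| Sl_And2: "And A B \<in> Sl G \<Longrightarrow> B \<in> Sl G"
| Sl_Or1: "Or A B \<in> Sl G \<Longrightarrow> A \<in> Sl G"
| Sl_Or2: "Or A B \<in> Sl G \<Longrightarrow> B \<in> Sl G"
| Sr_And1: "And A B \<in> Sr G \<Longrightarrow> A \<in> Sr G"
| Sr_And2: "And A B \<in> Sr G \<Longrightarrow> B \<in> Sr G"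
| Sr_Or1: "Or A B \<in> Sr G \<Longrightarrow> A \<in> Sr G"
| Sr_Or2: "Or A B \<in> Sr G \<Longrightarrow> B \<in> Sr G"
| Sl_Imp2: "Imp A B \<in> Sl G \<Longrightarrow> B \<in> Sl G"
| Sl_Imp1: "Imp A B \<in> Sl G \<Longrightarrow> A \<in> Sr G"
| Sr_Imp2: "Imp A B \<in> Sr G \<Longrightarrow> B \<in> Sr G"
| Sr_Imp1: "Imp A B \<in> Sr G \<Longrightarrow> A \<in> Sl G"

inductive_set Cl :: "form set \<Rightarrow> form set" for \<Gamma> :: "form set" where
  Cl_base: "X \<in> \<Gamma> \<Longrightarrow> X \<in> Cl \<Gamma>"
| Cl_And: "X \<in> Cl \<Gamma> \<Longrightarrow> Y \<in> Cl \<Gamma> \<Longrightarrow> And X Y \<in> Cl \<Gamma>"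
| Cl_Or2: "X \<in> Cl \<Gamma> \<Longrightarrow> Or A X \<in> Cl \<Gamma>"
| Cl_Or1: "X \<in> Cl \<Gamma> \<Longrightarrow> Or X A \<in> Cl \<Gamma>"
| Cl_Imp: "X \<in> Cl \<Gamma> \<Longrightarrow> Imp A X \<in> Cl \<Gamma>"

definition barAt :: "form \<Rightarrow> form set" where
  "barAt G = Sl G \<inter> Vars"

definition barImp :: "form \<Rightarrow> form set" where
  "barImp G = Sl G \<inter> Imps"

definition bar :: "form \<Rightarrow> form set" where
  "bar G = barAt G \<union> barImp G"

text \<open>\<open>Reg \<Gamma> C\<close> is the regular sequent \<open>\<Gamma> \<Rightarrow> C\<close> and \<open>Irr \<Sigma> \<Theta> C\<close> the irregular
  sequent \<open>\<Sigma>; \<Theta> \<rightarrow> C\<close>.\<close>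

datatype sequent =
    Reg "form set" form
  | Irr "form set" "form set" form

fun FRJ_sequent :: "form \<Rightarrow> sequent \<Rightarrow> bool" where
  "FRJ_sequent G (Reg \<Gamma> C) \<longleftrightarrow> \<Gamma> \<subseteq> bar G \<and> C \<in> Sr G"
| "FRJ_sequent G (Irr \<Sigma> \<Theta> C) \<longleftrightarrow> \<Sigma> \<union> \<Theta> \<subseteq> bar G \<and> C \<in> Sr G"

text \<open>The premises of a join rule are \<open>Irr (\<Sigma> j) (\<Theta> j) (A j)\<close> for \<open>1 \<le> j \<le> n\<close>; the values of
  \<open>\<Sigma>\<close>, \<open>\<Theta>\<close>, \<open>A\<close> at other indices are irrelevant.\<close>

definition join_\<Upsilon> :: "nat \<Rightarrow> (nat \<Rightarrow> form) \<Rightarrow> form set" where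
  "join_\<Upsilon> n A = A ` {1..n}"

definition join_\<Sigma>At :: "nat \<Rightarrow> (nat \<Rightarrow> form set) \<Rightarrow> form set" where
  "join_\<Sigma>At n \<Sigma> = (\<Union>j\<in>{1..n}. \<Sigma> j \<inter> Vars)"

definition join_\<Sigma>Imp :: "nat \<Rightarrow> (nat \<Rightarrow> form set) \<Rightarrow> form set" where
  "join_\<Sigma>Imp n \<Sigma> = (\<Union>j\<in>{1..n}. \<Sigma> j \<inter> Imps)"

definition join_\<Theta>At :: "nat \<Rightarrow> (nat \<Rightarrow> form set) \<Rightarrow> form set" where
  "join_\<Theta>At n \<Theta> = (\<Inter>j\<in>{1..n}. \<Theta> j \<inter> Vars)"

definition join_\<Theta>Imp :: "nat \<Rightarrow> (nat \<Rightarrow> form set) \<Rightarrow> (nat \<Rightarrow> form) \<Rightarrow> form set" where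
  "join_\<Theta>Imp n \<Theta> A =
     {Imp Y Z | Y Z. Imp Y Z \<in> (\<Inter>j\<in>{1..n}. \<Theta> j \<inter> Imps) \<and> Y \<in> join_\<Upsilon> n A}"

definition J1 :: "nat \<Rightarrow> (nat \<Rightarrow> form set) \<Rightarrow> (nat \<Rightarrow> form set) \<Rightarrow> bool" where
  "J1 n \<Sigma> \<Theta> \<longleftrightarrow> (\<forall>i\<in>{1..n}. \<forall>j\<in>{1..n}. i \<noteq> j \<longrightarrow> \<Sigma> i \<subseteq> \<Sigma> j \<union> \<Theta> j)"

definition J2 :: "nat \<Rightarrow> (nat \<Rightarrow> form set) \<Rightarrow> (nat \<Rightarrow> form) \<Rightarrow> bool" where
  "J2 n \<Sigma> A \<longleftrightarrow> (\<forall>Y Z. Imp Y Z \<in> join_\<Sigma>Imp n \<Sigma> \<longrightarrow> Y \<in> join_\<Upsilon> n A)"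

inductive FRJ :: "form \<Rightarrow> sequent \<Rightarrow> bool" for G :: form where
  Ax_reg: "\<lbrakk>F \<in> VarsBot; F \<in> Sr G\<rbrakk>
    \<Longrightarrow> FRJ G (Reg (barAt G - {F}) F)"
| Ax_irr: "\<lbrakk>F \<in> VarsBot; F \<in> Sr G\<rbrakk>
    \<Longrightarrow> FRJ G (Irr {} ((barAt G - {F}) \<union> barImp G) F)"
| And_reg: "\<lbrakk>FRJ G (Reg \<Gamma> A); A = A1 \<or> A = A2; And A1 A2 \<in> Sr G\<rbrakk>
    \<Longrightarrow> FRJ G (Reg \<Gamma> (And A1 A2))"
| And_irr: "\<lbrakk>FRJ G (Irr \<Sigma> \<Theta> A); A = A1 \<or> A = A2; And A1 A2 \<in> Sr G\<rbrakk>
    \<Longrightarrow> FRJ G (Irr \<Sigma> \<Theta> (And A1 A2))"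
| Or_irr: "\<lbrakk>FRJ G (Irr \<Sigma>1 \<Theta>1 C1); FRJ G (Irr \<Sigma>2 \<Theta>2 C2);
      \<Sigma>1 \<subseteq> \<Sigma>2 \<union> \<Theta>2; \<Sigma>2 \<subseteq> \<Sigma>1 \<union> \<Theta>1; Or C1 C2 \<in> Sr G\<rbrakk>
    \<Longrightarrow> FRJ G (Irr (\<Sigma>1 \<union> \<Sigma>2) (\<Theta>1 \<inter> \<Theta>2) (Or C1 C2))"
| Imp_in_reg: "\<lbrakk>FRJ G (Reg \<Gamma> B); A \<in> Cl \<Gamma>; Imp A B \<in> Sr G\<rbrakk>
    \<Longrightarrow> FRJ G (Reg \<Gamma> (Imp A B))"
| Imp_in_irr: "\<lbrakk>FRJ G (Irr \<Sigma> (\<Theta> \<union> \<Lambda>) B); \<Theta> \<inter> \<Lambda> = {}; A \<in> Cl (\<Sigma> \<union> \<Lambda>); Imp A B \<in> Sr G\<rbrakk>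
    \<Longrightarrow> FRJ G (Irr (\<Sigma> \<union> \<Lambda>) \<Theta> (Imp A B))"
| Imp_notin: "\<lbrakk>FRJ G (Reg \<Gamma> B); \<Theta> \<subseteq> Cl \<Gamma> \<inter> bar G; A \<in> Cl \<Gamma> - Cl \<Theta>; Imp A B \<in> Sr G\<rbrakk>
    \<Longrightarrow> FRJ G (Irr {} \<Theta> (Imp A B))"
| Join_At: "\<lbrakk>1 \<le> n; \<forall>j\<in>{1..n}. FRJ G (Irr (\<Sigma> j) (\<Theta> j) (A j)); J1 n \<Sigma> \<Theta>; J2 n \<Sigma> A;
      F \<in> VarsBot - join_\<Sigma>At n \<Sigma>; F \<in> Sr G\<rbrakk>
    \<Longrightarrow> FRJ G (Reg (join_\<Sigma>At n \<Sigma> \<union> (join_\<Theta>At n \<Theta> - {F}) \<union> join_\<Sigma>Imp n \<Sigma> \<union> join_\<Theta>Imp n \<Theta> A) F)"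
| Join_Or: "\<lbrakk>1 \<le> n; \<forall>j\<in>{1..n}. FRJ G (Irr (\<Sigma> j) (\<Theta> j) (A j)); J1 n \<Sigma> \<Theta>; J2 n \<Sigma> A;
      {C1, C2} \<subseteq> join_\<Upsilon> n A; Or C1 C2 \<in> Sr G\<rbrakk>
    \<Longrightarrow> FRJ G (Reg (join_\<Sigma>At n \<Sigma> \<union> join_\<Theta>At n \<Theta> \<union> join_\<Sigma>Imp n \<Sigma> \<union> join_\<Theta>Imp n \<Theta> A) (Or C1 C2))"

text \<open>The rules only constrain the right formula of the conclusion; that the left-hand sides of
  derivable sequents stay within \<open>bar G\<close> is a consequence.\<close>

lemma FRJ_imp_FRJ_sequent: "FRJ G s \<Longrightarrow> FRJ_sequent G s"
proof (induction rule: FRJ.induct)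
  case (Join_At n \<Sigma> \<Theta> A F)
  then have "\<forall>j\<in>{1..n}. \<Sigma> j \<union> \<Theta> j \<subseteq> bar G" and "1 \<in> {1..n}" by auto
  then show ?case
    using Join_At.hyps
    by (fastforce simp: join_\<Sigma>At_def join_\<Sigma>Imp_def join_\<Theta>At_def join_\<Theta>Imp_def)
next
  case (Join_Or n \<Sigma> \<Theta> A C1 C2)
  then have "\<forall>j\<in>{1..n}. \<Sigma> j \<union> \<Theta> j \<subseteq> bar G" and "1 \<in> {1..n}" by auto
  then show ?case
    using Join_Or.hyps
    by (fastforce simp: join_\<Sigma>At_def join_\<Sigma>Imp_def join_\<Theta>At_def join_\<Theta>Imp_def)
qed (auto simp: bar_def)

definition FRJ_provable :: "form \<Rightarrow> bool" where
  "FRJ_provable G \<longleftrightarrow> (\<exists>\<Gamma>. FRJ G (Reg \<Gamma> G))"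

record 'w kripke =
  worlds :: "'w set"
  le :: "('w \<times> 'w) set"
  root :: 'w
  val :: "'w \<Rightarrow> nat set"

definition finite_rooted_kripke :: "'w kripke \<Rightarrow> bool" where
  "finite_rooted_kripke K \<longleftrightarrow>
     finite (worlds K) \<and>
     partial_order_on (worlds K) (le K) \<and>
     root K \<in> worlds K \<and>
     (\<forall>w\<in>worlds K. (root K, w) \<in> le K) \<and>
     (\<forall>(v, w)\<in>le K. val K v \<subseteq> val K w)"

primrec forces :: "'w kripke \<Rightarrow> 'w \<Rightarrow> form \<Rightarrow> bool" where
  "forces K w (Var p) \<longleftrightarrow> p \<in> val K w"
| "forces K w Bot \<longleftrightarrow> False"
| "forces K w (And A B) \<longleftrightarrow> forces K w A \<and> forces K w B"
| "forces K w (Or A B) \<longleftrightarrow> forces K w A \<or> forces K w B"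
| "forces K w (Imp A B) \<longleftrightarrow>
     (\<forall>v\<in>worlds K. (w, v) \<in> le K \<longrightarrow> forces K v A \<longrightarrow> forces K v B)"

text \<open>HOL cannot quantify over the type of worlds inside a definition. Worlds are taken to be
  natural numbers, which covers every finite model up to isomorphism.\<close>

definition IPL :: "form set" where
  "IPL = {A. \<forall>K :: nat kripke. finite_rooted_kripke K \<longrightarrow> forces K (root K) A}"

end

theory Submission
  imports Defs
begin

text \<open>
  A regular sequent \<open>\<Gamma> \<Rightarrow> C\<close> is read as: some finite tree model forces \<open>\<Gamma>\<close> but not \<open>C\<close> at its root.
  An irregular sequent \<open>\<Sigma>; \<Theta> \<rightarrow> C\<close> is read as: there are finitely many tree models forcing
  \<open>\<Sigma> \<union> \<Theta>\<close> such that every world below all of them refutes \<open>C\<close>, provided that its atoms lie in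
  \<open>\<Sigma> \<union> \<Theta>\<close> and that it forces those members of \<open>\<Sigma>\<close> that are smaller than \<open>C\<close>. A join rule puts a new
  root below the trees of all its premises. The restriction to smaller formulas is what makes
  this work: the new root forces \<open>Y \<supset> Z\<close> because it refutes \<open>Y\<close>, and that in turn only depends
  on the forcing of formulas smaller than \<open>Y\<close>, so the circularity is resolved by induction on size.
\<close>

section \<open>Finite trees as Kripke models\<close>

datatype tree = Node (label: "nat set") "tree list"

primrec subtrees :: "tree \<Rightarrow> tree set" where
  "subtrees (Node V ts) = insert (Node V ts) (\<Union> (set (map subtrees ts)))"

lemma subtrees_refl [simp]: "t \<in> subtrees t"
  by (cases t) simp

lemma finite_subtrees: "finite (subtrees t)"
  by (induction t) auto

lemma subtrees_trans: "s \<in> subtrees t \<Longrightarrow> u \<in> subtrees s \<Longrightarrow> u \<in> subtrees t"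
  by (induction t) auto

lemma subtrees_size: "s \<in> subtrees t \<Longrightarrow> s = t \<or> size s < size t"
proof (induction t)
  case (Node V ts)
  then show ?case
  proof (cases "s = Node V ts")
    case False
    with Node.prems obtain t where t: "t \<in> set ts" "s \<in> subtrees t" by auto
    then have "size t < size (Node V ts)"
      by (simp add: less_Suc_eq_le size_list_estimation')
    with Node.IH[OF t] show ?thesis by auto
  qed simp
qed

lemma subtrees_antisym: "s \<in> subtrees t \<Longrightarrow> t \<in> subtrees s \<Longrightarrow> s = t"
  by (auto dest!: subtrees_size)

text \<open>All trees live in one infinite model, so a new root put below given trees leaves forcing
  at those trees unchanged. Equal subtrees count as a single world, which does not affect forcing.
  No tree lies below all others, hence the dummy \<open>root\<close>.\<close>

definition tree_model :: "tree kripke" where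
  "tree_model = \<lparr>worlds = UNIV, le = {(t, s). s \<in> subtrees t}, root = undefined, val = label\<rparr>"

abbreviation tforces :: "tree \<Rightarrow> form \<Rightarrow> bool" where
  "tforces \<equiv> forces tree_model"

lemma val_tree_model [simp]: "val tree_model = label"
  by (simp add: tree_model_def)

lemma tforces_Var: "tforces t (Var p) \<longleftrightarrow> p \<in> label t"
  by simp

lemma tforces_Imp:
  "tforces t (Imp A B) \<longleftrightarrow> (\<forall>s\<in>subtrees t. tforces s A \<longrightarrow> tforces s B)"
  by (auto simp: tree_model_def)

definition monotone_tree :: "tree \<Rightarrow> bool" where
  "monotone_tree t \<longleftrightarrow> (\<forall>s\<in>subtrees t. \<forall>u\<in>subtrees s. label s \<subseteq> label u)"

lemma monotone_tree_subtree: "monotone_tree t \<Longrightarrow> s \<in> subtrees t \<Longrightarrow> monotone_tree s"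
  unfolding monotone_tree_def by (blast intro: subtrees_trans)

lemma monotone_tree_Node:
  assumes "\<And>t. t \<in> set ts \<Longrightarrow> monotone_tree t \<and> V \<subseteq> label t"
  shows "monotone_tree (Node V ts)"
  using assms unfolding monotone_tree_def by fastforce

lemma tforces_mono:
  "monotone_tree t \<Longrightarrow> tforces t A \<Longrightarrow> s \<in> subtrees t \<Longrightarrow> tforces s A"
proof (induction A)
  case (Var p)
  then show ?case
    unfolding tforces_Var monotone_tree_def using subtrees_refl by blast
next
  case (Imp A B)
  then show ?case unfolding tforces_Imp using subtrees_trans by blast
qed auto

text \<open>The members of \<open>\<Gamma>\<close> from which \<open>A\<close> is built are
  subformulas of \<open>A\<close>, so forcing those of size at most that of \<open>A\<close>
  suffices. This bound is what the irregular rule \<open>Imp_in_irr\<close> can supply. The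
  implication case rests on persistence.\<close>

lemma tforces_Cl:
  assumes "A \<in> Cl \<Gamma>" "monotone_tree t"
    "\<And>X. X \<in> \<Gamma> \<Longrightarrow> size X \<le> size A \<Longrightarrow> tforces t X"
  shows "tforces t A"
  using assms
proof (induction rule: Cl.induct)
  case (Cl_Imp X A)
  then have "tforces t X" by simp
  with Cl_Imp.prems(1) show ?case using tforces_mono tforces_Imp by blast
qed auto

text \<open>\<open>IPL\<close> quantifies over models on \<open>nat\<close>, so the subtrees are numbered by an injection.\<close>

lemma tforces_IPL:
  assumes "monotone_tree t" "A \<in> IPL"
  shows "tforces t A"
proof -
  obtain f :: "tree \<Rightarrow> nat" where f: "inj_on f (subtrees t)"
    using finite_imp_inj_to_nat_seg[OF finite_subtrees] by blast
  define K where "K = \<lparr>worlds = f ` subtrees t,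
    le = {(f s, f u) | s u. s \<in> subtrees t \<and> u \<in> subtrees s}, root = f t,
    val = label \<circ> inv_into (subtrees t) f\<rparr>"
  have val: "val K (f s) = label s" if "s \<in> subtrees t" for s
    using that f by (simp add: K_def)
  have le: "(f s, f u) \<in> le K \<longleftrightarrow> u \<in> subtrees s" if "s \<in> subtrees t" "u \<in> subtrees t" for s u
  proof
    assume "(f s, f u) \<in> le K"
    then obtain s' u' where "f s = f s'" "f u = f u'" "s' \<in> subtrees t" "u' \<in> subtrees s'"
      by (auto simp: K_def)
    with that show "u \<in> subtrees s" by (metis f inj_onD subtrees_trans)
  qed (use that in \<open>auto simp: K_def\<close>)
  have worlds: "worlds K = f ` subtrees t" and root: "root K = f t"
    by (simp_all add: K_def)
  have le_sub: "le K \<subseteq> worlds K \<times> worlds K"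
    by (auto simp: K_def intro: subtrees_trans)
  have "partial_order_on (worlds K) (le K)"
    unfolding partial_order_on_def preorder_on_def
  proof (intro conjI)
    show "refl_on (worlds K) (le K)"
      using le by (auto simp: refl_on_def worlds)
    show "trans (le K)"
    proof (rule transI)
      fix a b c assume ab: "(a, b) \<in> le K" and bc: "(b, c) \<in> le K"
      with le_sub obtain r s u where "a = f r" "b = f s" "c = f u"
        "r \<in> subtrees t" "s \<in> subtrees t" "u \<in> subtrees t"
        unfolding worlds by blast
      with ab bc show "(a, c) \<in> le K" using le subtrees_trans by blast
    qed
    show "antisym (le K)"
    proof (rule antisymI)
      fix a b assume ab: "(a, b) \<in> le K" and ba: "(b, a) \<in> le K"
      with le_sub obtain r s where "a = f r" "b = f s" "r \<in> subtrees t" "s \<in> subtrees t"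
        unfolding worlds by blast
      with ab ba show "a = b" using le subtrees_antisym by blast
    qed
  qed (use le_sub in auto)
  moreover have "val K a \<subseteq> val K b" if ab: "(a, b) \<in> le K" for a b
  proof -
    obtain r s where "a = f r" "b = f s" "r \<in> subtrees t" "s \<in> subtrees r"
      using ab by (auto simp: K_def)
    moreover from this have "s \<in> subtrees t" by (blast intro: subtrees_trans)
    ultimately show ?thesis using assms(1) by (simp add: val monotone_tree_def)
  qed
  ultimately have "finite_rooted_kripke K"
    unfolding finite_rooted_kripke_def worlds root
    by (simp add: finite_subtrees le split_beta)
  with assms(2) have "forces K (f t) A"
    unfolding IPL_def root[symmetric] by blast
  \<comment> \<open>Forcing at \<open>s\<close> looks only at subtrees of \<open>s\<close>, and
    these are all numbered in \<open>K\<close>, so the finite model and the infinite one agree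
    here.\<close>
  moreover have "forces K (f s) B \<longleftrightarrow> tforces s B" if "s \<in> subtrees t" for s B
    using that
  proof (induction B arbitrary: s)
    case (Var p)
    then show ?case by (simp add: val tforces_Var)
  next
    case (Imp B C)
    have "forces K (f s) (Imp B C) \<longleftrightarrow>
        (\<forall>u\<in>subtrees t. u \<in> subtrees s \<longrightarrow> forces K (f u) B \<longrightarrow> forces K (f u) C)"
      using le Imp.prems by (auto simp: worlds)
    also have "\<dots> \<longleftrightarrow> tforces s (Imp B C)"
      unfolding tforces_Imp using Imp subtrees_trans by blast
    finally show ?case .
  qed auto
  ultimately show ?thesis by simp
qed

section \<open>Semantic reading of sequents\<close>

text \<open>The roles of \<open>\<Sigma>\<close> and \<open>\<Theta>\<close> differ only at
  \<open>u\<close>: there \<open>\<Theta>\<close> merely bounds the label, and its members may fail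
  at \<open>u\<close> although every tree in \<open>T\<close> forces them. \<open>T\<close> may be
  empty, as for axioms. Since \<open>u\<close> is universally quantified, its choice is postponed
  until a join.\<close>

definition irr_sound :: "tree set \<Rightarrow> form set \<Rightarrow> form set \<Rightarrow> form \<Rightarrow> bool" where
  "irr_sound T \<Sigma> \<Theta> C \<longleftrightarrow>
     (\<forall>t\<in>T. monotone_tree t \<and> (\<forall>X\<in>\<Sigma> \<union> \<Theta>. tforces t X)) \<and>
     (\<forall>u. monotone_tree u \<longrightarrow> T \<subseteq> subtrees u \<longrightarrow> Var ` label u \<subseteq> \<Sigma> \<union> \<Theta> \<longrightarrow>
        (\<forall>X\<in>\<Sigma>. size X < size C \<longrightarrow> tforces u X) \<longrightarrow> \<not> tforces u C)"

lemma irr_soundD: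
  assumes "irr_sound T \<Sigma> \<Theta> C"
  shows "t \<in> T \<Longrightarrow> monotone_tree t" "t \<in> T \<Longrightarrow> X \<in> \<Sigma> \<union> \<Theta> \<Longrightarrow> tforces t X"
    "\<lbrakk>monotone_tree u; T \<subseteq> subtrees u; Var ` label u \<subseteq> \<Sigma> \<union> \<Theta>;
      \<And>X. X \<in> \<Sigma> \<Longrightarrow> size X < size C \<Longrightarrow> tforces u X\<rbrakk> \<Longrightarrow> \<not> tforces u C"
  using assms unfolding irr_sound_def by blast+

fun sound :: "sequent \<Rightarrow> bool" where
  "sound (Reg \<Gamma> C) \<longleftrightarrow> (\<exists>t. monotone_tree t \<and> (\<forall>X\<in>\<Gamma>. tforces t X) \<and> \<not> tforces t C)"
| "sound (Irr \<Sigma> \<Theta> C) \<longleftrightarrow> (\<exists>T. finite T \<and> irr_sound T \<Sigma> \<Theta> C)"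

section \<open>Joining trees below a new root\<close>

text \<open>The trees of the premises force \<open>\<Sigma> j \<union> \<Theta> j\<close>, hence
  \<open>\<Gamma>\<close>, so strictly above the new root every implication of
  \<open>\<Gamma>\<close> holds. At the root itself it holds because its antecedent is some
  \<open>A j\<close>, which is refuted there.\<close>

lemma join_tree:
  assumes "finite J"
    and prem: "\<And>j. j \<in> J \<Longrightarrow> sound (Irr (\<Sigma> j) (\<Theta> j) (A j))"
    and \<Gamma>_sub: "\<And>j. j \<in> J \<Longrightarrow> \<Gamma> \<subseteq> \<Sigma> j \<union> \<Theta> j"
    and \<Sigma>_sub: "\<And>j. j \<in> J \<Longrightarrow> \<Sigma> j \<subseteq> \<Gamma>"
    and \<Gamma>_shape: "\<Gamma> \<subseteq> Vars \<union> Imps"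
    and \<Gamma>_Imp: "\<And>Y Z. Imp Y Z \<in> \<Gamma> \<Longrightarrow> Y \<in> A ` J"
  obtains u where "monotone_tree u" "label u = {p. Var p \<in> \<Gamma>}"
    "\<And>X. X \<in> \<Gamma> \<Longrightarrow> tforces u X" "\<And>j. j \<in> J \<Longrightarrow> \<not> tforces u (A j)"
proof -
  have "\<forall>j\<in>J. \<exists>T. finite T \<and> irr_sound T (\<Sigma> j) (\<Theta> j) (A j)"
    using prem by simp
  from bchoice[OF this] obtain T
    where "\<forall>j\<in>J. finite (T j) \<and> irr_sound (T j) (\<Sigma> j) (\<Theta> j) (A j)" ..
  then have T: "finite (T j)" "irr_sound (T j) (\<Sigma> j) (\<Theta> j) (A j)" if "j \<in> J" for j
    using that by simp_all
  have "finite (\<Union>j\<in>J. T j)" using assms(1) T(1) by simp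
  from finite_list[OF this] obtain ts where ts: "set ts = (\<Union>j\<in>J. T j)" ..
  define u where "u = Node {p. Var p \<in> \<Gamma>} ts"
  have lab: "label u = {p. Var p \<in> \<Gamma>}" by (simp add: u_def)
  have child: "monotone_tree t" "X \<in> \<Gamma> \<Longrightarrow> tforces t X" if "t \<in> set ts" for t X
  proof -
    from that obtain j where j: "j \<in> J" "t \<in> T j" unfolding ts by blast
    then show "monotone_tree t" using irr_soundD(1) T(2) by blast
    show "tforces t X" if "X \<in> \<Gamma>"
      using irr_soundD(2)[OF T(2)[OF j(1)] j(2)] \<Gamma>_sub[OF j(1)] that by blast
  qed
  have mono: "monotone_tree u"
    unfolding u_def
    by (rule monotone_tree_Node) (use child(1) child(2)[where X = "Var _"] in \<open>auto simp: tforces_Var\<close>)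
  have sub: "T j \<subseteq> subtrees u" if "j \<in> J" for j
    using that ts by (fastforce simp: u_def)
  \<comment> \<open>Stated conditionally, so that it can be used inside the induction on size below,
    where only smaller members of \<open>\<Gamma>\<close> are known to be forced.\<close>
  have refutes: "\<not> tforces u (A j)"
    if "j \<in> J" and small: "\<And>X. X \<in> \<Gamma> \<Longrightarrow> size X < size (A j) \<Longrightarrow> tforces u X" for j
  proof (rule irr_soundD(3)[OF T(2)[OF that(1)] mono sub[OF that(1)]])
    show "Var ` label u \<subseteq> \<Sigma> j \<union> \<Theta> j" using \<Gamma>_sub[OF that(1)] by (auto simp: lab)
  qed (use small \<Sigma>_sub that in blast)
  have forces: "tforces u X" if "X \<in> \<Gamma>" for X
    using that
  proof (induction "size X" arbitrary: X rule: less_induct)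
    case less
    consider p where "X = Var p" | Y Z where "X = Imp Y Z"
      using less.prems \<Gamma>_shape by (auto simp: Vars_def Imps_def)
    then show ?case
    proof cases
      case 1
      with less.prems show ?thesis by (simp add: tforces_Var lab)
    next
      case 2
      with less.prems \<Gamma>_Imp obtain j where j: "j \<in> J" "Y = A j" by blast
      \<comment> \<open>Whatever is smaller than \<open>Y\<close> is smaller than \<open>X\<close>,
        so the induction hypothesis discharges the condition of \<open>refutes\<close>.\<close>
      have "\<not> tforces u Y"
        unfolding j(2) by (rule refutes[OF j(1)], rule less.hyps) (use 2 j in auto)
      moreover have "tforces s Z" if "t \<in> set ts" "s \<in> subtrees t" "tforces s Y" for s t
        using that child(2)[OF _ less.prems, of t] unfolding 2 tforces_Imp by blast
      ultimately show ?thesis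
        unfolding 2 tforces_Imp by (auto simp: u_def)
    qed
  qed
  show thesis
    using that mono lab forces refutes by blast
qed

text \<open>\<open>P\<close> is the atomic part taken from the \<open>\<Theta> j\<close>; it lets
  one lemma serve both join rules, with \<open>F\<close> removed in \<open>Join_At\<close> and
  nothing removed in \<open>Join_Or\<close>. J1 places \<open>\<Gamma>\<close> inside each premise,
  while J2 and the definition of \<open>join_\<Theta>Imp\<close> put all antecedents among the
  \<open>A j\<close>. Derivability of the premises is carried along because it confines each
  \<open>\<Sigma> j\<close> to variables and implications.\<close>

lemma FRJ_join_tree:
  fixes \<Sigma> \<Theta> :: "nat \<Rightarrow> form set"
  assumes n: "1 \<le> n"
    and prem: "\<forall>j\<in>{1..n}. FRJ G (Irr (\<Sigma> j) (\<Theta> j) (A j)) \<and> sound (Irr (\<Sigma> j) (\<Theta> j) (A j))"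
    and J1: "J1 n \<Sigma> \<Theta>" and J2: "J2 n \<Sigma> A" and P: "P \<subseteq> join_\<Theta>At n \<Theta>"
    and \<Gamma>: "\<Gamma> = join_\<Sigma>At n \<Sigma> \<union> P \<union> join_\<Sigma>Imp n \<Sigma> \<union> join_\<Theta>Imp n \<Theta> A"
  obtains u where "monotone_tree u" "label u = {p. Var p \<in> \<Gamma>}"
    "\<And>X. X \<in> \<Gamma> \<Longrightarrow> tforces u X" "\<And>j. j \<in> {1..n} \<Longrightarrow> \<not> tforces u (A j)"
proof (rule join_tree)
  show "finite {1..n}" by simp
  show "sound (Irr (\<Sigma> j) (\<Theta> j) (A j))" if "j \<in> {1..n}" for j using prem that by blast
  have 1: "\<Sigma> i \<subseteq> \<Sigma> j \<union> \<Theta> j" if "i \<in> {1..n}" "j \<in> {1..n}" for i j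
    using J1 that unfolding J1_def by (cases "i = j") blast+
  show "\<Gamma> \<subseteq> \<Sigma> j \<union> \<Theta> j" if j: "j \<in> {1..n}" for j
    using 1[OF _ j] P j
    unfolding \<Gamma> join_\<Sigma>At_def join_\<Theta>At_def join_\<Sigma>Imp_def join_\<Theta>Imp_def by blast
  show "\<Sigma> j \<subseteq> \<Gamma>" if j: "j \<in> {1..n}" for j
  proof -
    have "\<Sigma> j \<subseteq> Vars \<union> Imps"
      using FRJ_imp_FRJ_sequent prem j by (fastforce simp: bar_def barAt_def barImp_def)
    with j show ?thesis unfolding \<Gamma> join_\<Sigma>At_def join_\<Sigma>Imp_def by blast
  qed
  \<comment> \<open>The hypothesis \<open>n\<close> matters: over an empty index set the
    intersection in \<open>join_\<Theta>At\<close> would be the set of all formulas.\<close>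
  show "\<Gamma> \<subseteq> Vars \<union> Imps"
    using P n unfolding \<Gamma> join_\<Sigma>At_def join_\<Theta>At_def join_\<Sigma>Imp_def join_\<Theta>Imp_def Imps_def
    by fastforce
  show "Y \<in> A ` {1..n}" if "Imp Y Z \<in> \<Gamma>" for Y Z
  proof -
    have "Imp Y Z \<notin> join_\<Sigma>At n \<Sigma>" "Imp Y Z \<notin> P"
      using P n by (fastforce simp: join_\<Sigma>At_def join_\<Theta>At_def Vars_def)+
    with that J2 show ?thesis
      unfolding \<Gamma> J2_def join_\<Theta>Imp_def join_\<Upsilon>_def by blast
  qed
qed (use that in blast)

section \<open>Soundness rule by rule\<close>

lemma FRJ_sound: "FRJ G s \<Longrightarrow> sound s"
proof (induction rule: FRJ.induct)
  case (Ax_reg F)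
  define t where "t = Node {p. Var p \<in> barAt G - {F}} []"
  have "monotone_tree t" by (simp add: t_def monotone_tree_def)
  moreover have "\<forall>X\<in>barAt G - {F}. tforces t X"
    by (auto simp: barAt_def Vars_def t_def tforces_Var)
  moreover have "\<not> tforces t F"
    using Ax_reg by (auto simp: VarsBot_def Vars_def t_def tforces_Var)
  ultimately show ?case unfolding sound.simps by blast
next
  case (Ax_irr F)
  \<comment> \<open>No trees are required: a variable \<open>F\<close> cannot be in the label of
    \<open>u\<close>, as it is removed from the atoms and \<open>barImp G\<close> contains only
    implications.\<close>
  then have "irr_sound {} {} ((barAt G - {F}) \<union> barImp G) F"
    by (auto simp: irr_sound_def VarsBot_def Vars_def barImp_def Imps_def image_subset_iff)
  then show ?case unfolding sound.simps by blast
next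
  case (And_reg \<Gamma> A A1 A2)
  then show ?case by auto
next
  case (And_irr \<Sigma> \<Theta> A A1 A2)
  then obtain T where "finite T" and T: "irr_sound T \<Sigma> \<Theta> A" by auto
  \<comment> \<open>The conjunct \<open>A\<close> is smaller than the conjunction, so the size
    condition on \<open>\<Sigma>\<close> for the conclusion implies the one for the premise.\<close>
  have "irr_sound T \<Sigma> \<Theta> (And A1 A2)"
    using T And_irr.hyps(2) unfolding irr_sound_def by fastforce
  with \<open>finite T\<close> show ?case by auto
next
  case (Or_irr \<Sigma>1 \<Theta>1 C1 \<Sigma>2 \<Theta>2 C2)
  then obtain T1 T2 where fin: "finite T1" "finite T2"
    and T1: "irr_sound T1 \<Sigma>1 \<Theta>1 C1" and T2: "irr_sound T2 \<Sigma>2 \<Theta>2 C2" by auto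
  \<comment> \<open>The side conditions make the left-hand side of the conclusion fit into that of
    each premise, so both tree sets can be used together.\<close>
  have sub: "\<Sigma>1 \<union> \<Sigma>2 \<union> \<Theta>1 \<inter> \<Theta>2 \<subseteq> \<Sigma>1 \<union> \<Theta>1" "\<Sigma>1 \<union> \<Sigma>2 \<union> \<Theta>1 \<inter> \<Theta>2 \<subseteq> \<Sigma>2 \<union> \<Theta>2"
    using Or_irr.hyps by auto
  have "irr_sound (T1 \<union> T2) (\<Sigma>1 \<union> \<Sigma>2) (\<Theta>1 \<inter> \<Theta>2) (Or C1 C2)"
    unfolding irr_sound_def
  proof (intro conjI ballI allI impI)
    fix t assume "t \<in> T1 \<union> T2"
    then show "monotone_tree t" using irr_soundD(1)[OF T1] irr_soundD(1)[OF T2] by blast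
    fix X assume "X \<in> \<Sigma>1 \<union> \<Sigma>2 \<union> \<Theta>1 \<inter> \<Theta>2"
    with \<open>t \<in> T1 \<union> T2\<close> sub show "tforces t X"
      using irr_soundD(2)[OF T1] irr_soundD(2)[OF T2] by blast
  next
    fix u assume u: "monotone_tree u" "T1 \<union> T2 \<subseteq> subtrees u"
      "Var ` label u \<subseteq> \<Sigma>1 \<union> \<Sigma>2 \<union> \<Theta>1 \<inter> \<Theta>2"
      and small: "\<forall>X\<in>\<Sigma>1 \<union> \<Sigma>2. size X < size (Or C1 C2) \<longrightarrow> tforces u X"
    have "\<not> tforces u C1" by (rule irr_soundD(3)[OF T1 u(1)]) (use u sub small in auto)
    moreover have "\<not> tforces u C2" by (rule irr_soundD(3)[OF T2 u(1)]) (use u sub small in auto)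
    ultimately show "\<not> tforces u (Or C1 C2)" by simp
  qed
  with fin show ?case unfolding sound.simps by blast
next
  case (Imp_in_reg \<Gamma> B A)
  then obtain t where t: "monotone_tree t" "\<forall>X\<in>\<Gamma>. tforces t X" "\<not> tforces t B" by auto
  then have "tforces t A" using tforces_Cl Imp_in_reg.hyps(2) by blast
  with t show ?case unfolding sound.simps tforces_Imp using subtrees_refl by blast
next
  case (Imp_in_irr \<Sigma> \<Theta> \<Lambda> B A)
  then obtain T where "finite T" and T: "irr_sound T \<Sigma> (\<Theta> \<union> \<Lambda>) B" by auto
  have "irr_sound T (\<Sigma> \<union> \<Lambda>) \<Theta> (Imp A B)"
    unfolding irr_sound_def
  proof (intro conjI ballI allI impI)
    fix t assume "t \<in> T"
    then show "monotone_tree t" using irr_soundD(1)[OF T] by blast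
    fix X assume "X \<in> \<Sigma> \<union> \<Lambda> \<union> \<Theta>"
    with \<open>t \<in> T\<close> show "tforces t X" using irr_soundD(2)[OF T] by blast
  next
    fix u assume u: "monotone_tree u" "T \<subseteq> subtrees u" "Var ` label u \<subseteq> \<Sigma> \<union> \<Lambda> \<union> \<Theta>"
      and small: "\<forall>X\<in>\<Sigma> \<union> \<Lambda>. size X < size (Imp A B) \<longrightarrow> tforces u X"
    have "\<not> tforces u B" by (rule irr_soundD(3)[OF T u(1,2)]) (use u small in auto)
    \<comment> \<open>Formulas of size at most \<open>size A\<close> are strictly smaller than
      \<open>Imp A B\<close>, so \<open>small\<close> covers the members of
      \<open>\<Sigma> \<union> \<Lambda>\<close> that \<open>tforces_Cl\<close> asks for.\<close>
    moreover have "tforces u A" by (rule tforces_Cl[OF Imp_in_irr.hyps(3) u(1)]) (use small in auto)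
    ultimately show "\<not> tforces u (Imp A B)" unfolding tforces_Imp using subtrees_refl by blast
  qed
  with \<open>finite T\<close> show ?case unfolding sound.simps by blast
next
  case (Imp_notin \<Gamma> B \<Theta> A)
  then obtain t where t: "monotone_tree t" "\<forall>X\<in>\<Gamma>. tforces t X" "\<not> tforces t B" by auto
  have Cl: "tforces t X" if "X \<in> Cl \<Gamma>" for X using tforces_Cl[OF that] t by blast
  \<comment> \<open>The countermodel \<open>t\<close> of the premise forces \<open>A\<close> but not
    \<open>B\<close>, so it refutes the implication at every world below it.\<close>
  have "irr_sound {t} {} \<Theta> (Imp A B)"
    using t Cl Imp_notin.hyps(2,3) unfolding irr_sound_def tforces_Imp by blast
  then show ?case unfolding sound.simps by blast
next
  case (Join_At n \<Sigma> \<Theta> A F)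
  let ?\<Gamma> = "join_\<Sigma>At n \<Sigma> \<union> (join_\<Theta>At n \<Theta> - {F}) \<union> join_\<Sigma>Imp n \<Sigma> \<union> join_\<Theta>Imp n \<Theta> A"
  obtain u where u: "monotone_tree u" "label u = {p. Var p \<in> ?\<Gamma>}" "\<And>X. X \<in> ?\<Gamma> \<Longrightarrow> tforces u X"
    using FRJ_join_tree[OF Join_At.hyps(1) _ Join_At.hyps(2,3) Diff_subset refl] Join_At.IH
    by metis
  \<comment> \<open>If \<open>F\<close> is a variable, it is outside \<open>join_\<Sigma>At\<close>
    by the side condition and removed from \<open>join_\<Theta>At\<close>; the other two parts
    contain only implications. Thus the label of \<open>u\<close> omits it.\<close>
  have "\<not> tforces u F"
    using Join_At.hyps(4)
    by (auto simp: VarsBot_def Vars_def tforces_Var u(2) join_\<Sigma>Imp_def join_\<Theta>Imp_def Imps_def)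
  with u(1,3) show ?case unfolding sound.simps by blast
next
  case (Join_Or n \<Sigma> \<Theta> A C1 C2)
  let ?\<Gamma> = "join_\<Sigma>At n \<Sigma> \<union> join_\<Theta>At n \<Theta> \<union> join_\<Sigma>Imp n \<Sigma> \<union> join_\<Theta>Imp n \<Theta> A"
  obtain u where u: "monotone_tree u" "\<And>X. X \<in> ?\<Gamma> \<Longrightarrow> tforces u X"
    "\<And>j. j \<in> {1..n} \<Longrightarrow> \<not> tforces u (A j)"
    using FRJ_join_tree[OF Join_Or.hyps(1) _ Join_Or.hyps(2,3) subset_refl refl] Join_Or.IH
    by metis
  have "\<not> tforces u (Or C1 C2)"
    using Join_Or.hyps(4) u(3) by (auto simp: join_\<Upsilon>_def)
  with u(1,2) show ?case unfolding sound.simps by blast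
qed

theorem theorem3p1:
  fixes G :: form
  assumes "FRJ_provable G"
  shows "G \<notin> IPL"
proof
  assume "G \<in> IPL"
  moreover obtain t where "monotone_tree t" "\<not> tforces t G"
    using assms FRJ_sound unfolding FRJ_provable_def by fastforce
  ultimately show False using tforces_IPL by blast
qed

end
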